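(* For any $\sigma$-program $P$, the relation $\le_P^{[\le\omega]}$ is a total order on $\mathrm{Lab}_P^{[\le\omega]}$, and $(\mathrm{Lab}_P^{[\le\omega]},\le_P^{[\le\omega]})$ can be isomorphically embedded into $(\mathbb R,\le)$.
   Context: **Programs.** Let $\sigma=(n_1;m_1,\ldots,m_{n_2};k_1,\ldots,k_{n_3})$ be a finite signature with constant symbols $c_i^0$, operation symbols $f_i^{m_i}$, relation symbols $r_i^{k_i}$. A $\sigma$-program $P$ is a list $1:\mathrm{instruction}_1;\ \ldots;\ \ell_P-1:\mathrm{instruction}_{\ell_P-1};\ \ell_P:\text{stop}$ with $\ell_P\ge1$, where each instruction with label $\ell<\ell_P$ has one of the forms: (1) $Z_j:=f_i^{m_i}(Z_{j_1},\ldots,Z_{j_{m_i}})$; (2) $Z_j:=c_i^0$; (3) $Z_{I_j}:=Z_{I_k}$; (4) if $r_i^{k_i}(Z_{j_1},\ldots,Z_{j_{k_i}})$ then goto $\ell_1'$ else goto $\ell_2'$; (5) if $I_j=I_k$ then goto $\ell_1'$ else goto $\ell_2'$; (6) $I_j:=1$; (7) $I_j:=I_j+1$; (11) goto $\ell_1'$ or goto $\ell_2'$; with $\ell_1',\ell_2'\in L_P=\{1,\ldots,\ell_P\}$. Let $L_P^{\circ}=\{1,\ldots,\ell_P-1\}$, $L_P^{\mathrm B}$ = labels of types (4),(5),(11), $L_P^{\mathrm{NB}}=L_P^\circ\setminus L_P^{\mathrm B}$. Put $\beta_P(\ell)=\ell+1$ for $\ell\in L_P^{\mathrm{NB}}$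 and, for $\ell\in L_P^{\mathrm B}$, $\beta_P^+(\ell)=\ell_1'$, $\beta_P^-(\ell)=\ell_2'$. **$P$-paths.** A finite $P$-path of length $s\ge1$ is $(\ell_1,\ldots,\ell_s)\in L_P^s$ with $\ell_1=1$, $\ell_s=\ell_P$, $\ell_t\in L_P^\circ$ for $t<s$, and for all $t<s$: $\ell_{t+1}=\beta_P(\ell_t)$ if $\ell_t\in L_P^{\mathrm{NB}}$, $\ell_{t+1}\in\{\beta_P^+(\ell_t),\beta_P^-(\ell_t)\}$ if $\ell_t\in L_P^{\mathrm B}$. An infinite $P$-path is $(\ell_1,\ell_2,\ldots)\in (L_P^\circ)^\omega$ with $\ell_1=1$ and the same successor rule for all $t\ge 1$. $\mathrm{Lab}_P^{[\le\omega]}$ consists of all infinite $P$-paths and all sequences $(\ell_1,\ldots,\ell_s,\ell_s,\ell_s,\ldots)$ with $(\ell_1,\ldots,\ell_s)$ a finite $P$-path. **The order.** For $B'=(\ell_{1,1},\ell_{1,2},\ldots)$ and $B''=(\ell_{2,1},\ell_{2,2},\ldots)$ in $\mathrm{Lab}_P^{[\le\omega]}$, $B'<_P^{[\le\omega]}B''$ holds iff there is $j\in\{2,3,\ldots\}$ with $\ell_{1,i}=\ell_{2,i}$ for all $i\in\{1,\ldots,j-1\}$, $\ell_{1,j}\ne\ell_{2,j}$, $\ell_{1,j}=\beta_P^+(\ell_{1,j-1})$ and $\ell_{2,j}=\beta_P^-(\ell_{1,j-1})$. $B'\le_P^{[\le\omega]}B''$ means $B'<_P^{[\le\omega]}B''$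 or $B'=B''$. *)

theory Defs
  imports Complex_Main "HOL-Library.Stream"
begin

text \<open>
  A signature \<open>(n\<^sub>1; m\<^sub>1,\<dots>,m\<^bsub>n2\<^esub>; k\<^sub>1,\<dots>,k\<^bsub>n3\<^esub>)\<close>: the number of constant symbols and the lists
  of arities of the operation and of the relation symbols. All symbols, registers and program
  labels are numbered from 1, so that the arity of the \<open>i\<close>-th symbol is found at list
  position \<open>i - 1\<close>.
\<close>

record signature =
  num_consts :: nat
  op_arities :: "nat list"
  rel_arities :: "nat list"

datatype instruction =
    Apply nat nat "nat list"         \<comment> \<open>\<open>Apply j i js\<close>: \<open>Z\<^sub>j := f\<^sub>i(Z\<^bsub>j1\<^esub>, \<dots>)\<close>\<close>
  | Load_Const nat nat               \<comment> \<open>\<open>Load_Const j i\<close>: \<open>Z\<^sub>j := c\<^sub>i\<close>\<close>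
  | Copy nat nat                     \<comment> \<open>\<open>Copy j k\<close>: \<open>Z\<close> at address \<open>I\<^sub>j\<close> := \<open>Z\<close> at address \<open>I\<^sub>k\<close>\<close>
  | If_Rel nat "nat list" nat nat    \<comment> \<open>\<open>If_Rel i js l1 l2\<close>: if \<open>r\<^sub>i(Z\<^bsub>j1\<^esub>, \<dots>)\<close> then goto \<open>l1\<close> else goto \<open>l2\<close>\<close>
  | If_Eq nat nat nat nat            \<comment> \<open>\<open>If_Eq j k l1 l2\<close>: if \<open>I\<^sub>j = I\<^sub>k\<close> then goto \<open>l1\<close> else goto \<open>l2\<close>\<close>
  | Set_One nat                      \<comment> \<open>\<open>I\<^sub>j := 1\<close>\<close>
  | Incr nat                         \<comment> \<open>\<open>I\<^sub>j := I\<^sub>j + 1\<close>\<close>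
  | Goto_Or nat nat                  \<comment> \<open>goto \<open>l1\<close> or goto \<open>l2\<close>\<close>
  | Stop

type_synonym program = "instruction list"

definition labels :: "program \<Rightarrow> nat set" where
  "labels P = {1..length P}"

definition inner_labels :: "program \<Rightarrow> nat set" where
  "inner_labels P = {1..<length P}"

definition instr_at :: "program \<Rightarrow> nat \<Rightarrow> instruction" where
  "instr_at P l = P ! (l - 1)"

text \<open>\<open>wf_instr \<sigma> L ins\<close>: \<open>ins\<close> is an admissible instruction other than \<open>stop\<close>,
  with jump targets in \<open>L\<close>.\<close>

fun wf_instr :: "signature \<Rightarrow> nat set \<Rightarrow> instruction \<Rightarrow> bool" where
  "wf_instr \<sigma> L (Apply j i js) \<longleftrightarrow>
     j \<ge> 1 \<and> i \<in> {1..length (op_arities \<sigma>)} \<and>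
     length js = op_arities \<sigma> ! (i - 1) \<and> (\<forall>x\<in>set js. x \<ge> 1)"
| "wf_instr \<sigma> L (Load_Const j i) \<longleftrightarrow> j \<ge> 1 \<and> i \<in> {1..num_consts \<sigma>}"
| "wf_instr \<sigma> L (Copy j k) \<longleftrightarrow> j \<ge> 1 \<and> k \<ge> 1"
| "wf_instr \<sigma> L (If_Rel i js l1 l2) \<longleftrightarrow>
     i \<in> {1..length (rel_arities \<sigma>)} \<and>
     length js = rel_arities \<sigma> ! (i - 1) \<and> (\<forall>x\<in>set js. x \<ge> 1) \<and> l1 \<in> L \<and> l2 \<in> L"
| "wf_instr \<sigma> L (If_Eq j k l1 l2) \<longleftrightarrow> j \<ge> 1 \<and> k \<ge> 1 \<and> l1 \<in> L \<and> l2 \<in> L"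
| "wf_instr \<sigma> L (Set_One j) \<longleftrightarrow> j \<ge> 1"
| "wf_instr \<sigma> L (Incr j) \<longleftrightarrow> j \<ge> 1"
| "wf_instr \<sigma> L (Goto_Or l1 l2) \<longleftrightarrow> l1 \<in> L \<and> l2 \<in> L"
| "wf_instr \<sigma> L Stop \<longleftrightarrow> False"

definition is_program :: "signature \<Rightarrow> program \<Rightarrow> bool" where
  "is_program \<sigma> P \<longleftrightarrow> P \<noteq> [] \<and> instr_at P (length P) = Stop \<and>
     (\<forall>l\<in>inner_labels P. wf_instr \<sigma> (labels P) (instr_at P l))"

fun branch_targets :: "instruction \<Rightarrow> (nat \<times> nat) option" where
  "branch_targets (If_Rel i js l1 l2) = Some (l1, l2)"
| "branch_targets (If_Eq j k l1 l2) = Some (l1, l2)"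
| "branch_targets (Goto_Or l1 l2) = Some (l1, l2)"
| "branch_targets _ = None"

definition branch_labels :: "program \<Rightarrow> nat set" where
  "branch_labels P = {l \<in> inner_labels P. branch_targets (instr_at P l) \<noteq> None}"

definition nonbranch_labels :: "program \<Rightarrow> nat set" where
  "nonbranch_labels P = inner_labels P - branch_labels P"

text \<open>The successor functions \<open>\<beta>\<close>, \<open>\<beta>\<^sup>+\<close>, \<open>\<beta>\<^sup>-\<close> are partial: the first is defined on the
  non-branching labels, the other two on the branching ones.\<close>

definition beta :: "program \<Rightarrow> nat \<rightharpoonup> nat" where
  "beta P l = (if l \<in> nonbranch_labels P then Some (l + 1) else None)"

definition beta_plus :: "program \<Rightarrow> nat \<rightharpoonup> nat" where
  "beta_plus P l = (if l \<in> branch_labels P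
     then map_option fst (branch_targets (instr_at P l)) else None)"

definition beta_minus :: "program \<Rightarrow> nat \<rightharpoonup> nat" where
  "beta_minus P l = (if l \<in> branch_labels P
     then map_option snd (branch_targets (instr_at P l)) else None)"

definition succ_label :: "program \<Rightarrow> nat \<Rightarrow> nat \<Rightarrow> bool" where
  "succ_label P l l' \<longleftrightarrow>
     (l \<in> nonbranch_labels P \<longrightarrow> beta P l = Some l') \<and>
     (l \<in> branch_labels P \<longrightarrow> beta_plus P l = Some l' \<or> beta_minus P l = Some l')"

text \<open>Positions in lists and streams are counted from 0: the entry \<open>\<ell>\<^sub>t\<close> of a path
  is at position \<open>t - 1\<close>.\<close>

definition finite_path :: "program \<Rightarrow> nat list \<Rightarrow> bool" where
  "finite_path P p \<longleftrightarrow> length p \<ge> 1 \<and> set p \<subseteq> labels P \<and> hd p = 1 \<and> last p = length P \<and>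
     (\<forall>t. t + 1 < length p \<longrightarrow> p ! t \<in> inner_labels P \<and> succ_label P (p ! t) (p ! (t + 1)))"

definition infinite_path :: "program \<Rightarrow> nat stream \<Rightarrow> bool" where
  "infinite_path P B \<longleftrightarrow> B \<in> streams (inner_labels P) \<and> B !! 0 = 1 \<and>
     (\<forall>t. succ_label P (B !! t) (B !! (t + 1)))"

definition Lab :: "program \<Rightarrow> nat stream set" where
  "Lab P = {B. infinite_path P B} \<union> {p @- sconst (last p) |p. finite_path P p}"

text \<open>Here \<open>j\<close> is the 0-based position of the first difference, hence \<open>j \<ge> 1\<close>.\<close>

definition path_less :: "program \<Rightarrow> nat stream \<Rightarrow> nat stream \<Rightarrow> bool" where
  "path_less P B1 B2 \<longleftrightarrow> (\<exists>j\<ge>1. (\<forall>i<j. B1 !! i = B2 !! i) \<and> B1 !! j \<noteq> B2 !! j \<and>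
     beta_plus P (B1 !! (j - 1)) = Some (B1 !! j) \<and>
     beta_minus P (B1 !! (j - 1)) = Some (B2 !! j))"

definition path_le :: "program \<Rightarrow> nat stream \<Rightarrow> nat stream \<Rightarrow> bool" where
  "path_le P B1 B2 \<longleftrightarrow> path_less P B1 B2 \<or> B1 = B2"

definition Lab_order :: "program \<Rightarrow> nat stream rel" where
  "Lab_order P = {(B1, B2). B1 \<in> Lab P \<and> B2 \<in> Lab P \<and> path_le P B1 B2}"

end

theory Submission
  imports Defs
begin

text \<open>
  A path is determined by its branching decisions. Recording each step as the digit 0 if it takes
  the \<open>\<beta>\<^sup>+\<close>-successor and 1 otherwise turns \<open>path_less\<close> into the lexicographic
  order of digit sequences, and reading the digits in base 3 embeds the latter into the reals: in
  that base a digit 1 outweighs all later digits, so no two expansions coincide. Antisymmetry and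
  transitivity are then inherited from the reals, and only totality has to be shown for the paths.
\<close>

lemma summable_ternary:
  fixes d :: "nat \<Rightarrow> real"
  assumes "\<And>i. d i \<in> {0..1}"
  shows "summable (\<lambda>i. d i * (1/3) ^ i)"
proof (rule summable_comparison_test')
  show "summable (\<lambda>i. (1/3 :: real) ^ i)"
    by (rule summable_geometric) simp
  show "norm (d i * (1/3) ^ i) \<le> (1/3) ^ i" for i
    using assms[of i] by (simp add: abs_mult mult_left_le_one_le)
qed

text \<open>At position \<open>k\<close> the sum for \<open>e\<close> gains
  \<open>(1/3) ^ k\<close>, while all later positions together lose at most the sum of
  \<open>(1/3) ^ i\<close> over \<open>i > k\<close>, which is only half of that gain.\<close>

lemma ternary_less:
  fixes d e :: "nat \<Rightarrow> real"
  assumes d: "\<And>i. d i \<in> {0..1}" and e: "\<And>i. e i \<in> {0..1}"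
    and eq: "\<And>i. i < k \<Longrightarrow> d i = e i" and "d k = 0" "e k = 1"
  shows "(\<Sum>i. d i * (1/3) ^ i) < (\<Sum>i. e i * (1/3) ^ i)"
proof -
  define g where "g i = (e i - d i) * (1/3) ^ i" for i
  have g_diff: "g = (\<lambda>i. e i * (1/3) ^ i - d i * (1/3) ^ i)"
    by (simp add: g_def fun_eq_iff algebra_simps)
  have g: "summable g"
    unfolding g_diff by (intro summable_diff summable_ternary d e)
  \<comment> \<open>The worst case for the tail: every later difference \<open>e i - d i\<close>
    equals -1.\<close>
  have geo: "(\<lambda>i. - ((1/3) ^ Suc k) * (1/3 :: real) ^ i) sums (- ((1/3) ^ Suc k) * (1 / (1 - 1/3)))"
    by (intro sums_mult geometric_sums) simp
  have "- ((1/3) ^ Suc k) * (1/3) ^ i \<le> g (i + Suc k)" for i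
  proof -
    have "- 1 \<le> e (i + Suc k) - d (i + Suc k)"
      using d[of "i + Suc k"] e[of "i + Suc k"] by simp
    then have "- 1 * (1/3) ^ (i + Suc k) \<le> g (i + Suc k)"
      unfolding g_def by (rule mult_right_mono) simp
    then show ?thesis by (simp add: power_add mult_ac)
  qed
  then have "- ((1/3) ^ Suc k) * (1 / (1 - 1/3)) \<le> (\<Sum>i. g (i + Suc k))"
    by (rule sums_le[OF _ geo summable_sums[OF summable_ignore_initial_segment[OF g]]])
  moreover have "(\<Sum>i<Suc k. g i) = (1/3) ^ k"
    using assms(3-5) by (simp add: g_def)
  moreover have "suminf g = (\<Sum>i. g (i + Suc k)) + (\<Sum>i<Suc k. g i)"
    by (rule suminf_split_initial_segment) (rule g)
  moreover have "- ((1/3) ^ Suc k) * (1 / (1 - 1/3)) = - ((1/3 :: real) ^ k / 2)" by simp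
  moreover have "(1/3 :: real) ^ k > 0" by simp
  ultimately have "suminf g > 0" by linarith
  then show ?thesis
    unfolding g_diff using suminf_diff[OF summable_ternary summable_ternary, of e d] d e by simp
qed

text \<open>At non-branching labels and in the padding after \<open>Stop\<close>,
  \<open>beta_plus\<close> is \<open>None\<close> and the digit is 1. This is harmless, since paths
  get equal digits for as long as they agree.\<close>

definition digit :: "program \<Rightarrow> nat stream \<Rightarrow> nat \<Rightarrow> real" where
  "digit P B t = of_bool (beta_plus P (B !! t) \<noteq> Some (B !! Suc t))"

definition path_value :: "program \<Rightarrow> nat stream \<Rightarrow> real" where
  "path_value P B = (\<Sum>t. digit P B t * (1/3) ^ t)"

lemma path_less_imp_value_less:
  assumes "path_less P B1 B2"
  shows "path_value P B1 < path_value P B2"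
proof -
  obtain j where j: "j \<ge> 1" "\<forall>i<j. B1 !! i = B2 !! i" "B1 !! j \<noteq> B2 !! j"
    "beta_plus P (B1 !! (j - 1)) = Some (B1 !! j)"
    using assms unfolding path_less_def by blast
  \<comment> \<open>The digit at \<open>k\<close> records the step from the last common label, at
    \<open>k\<close>, to the differing labels at \<open>j\<close>.\<close>
  then obtain k where k: "j = Suc k" by (cases j) auto
  show ?thesis
    unfolding path_value_def
  proof (rule ternary_less)
    show "digit P B1 t = digit P B2 t" if "t < k" for t
      using j(2) that by (simp add: digit_def k del: snth.simps)
    show "digit P B1 k = 0" using j by (simp add: digit_def k)
    show "digit P B2 k = 1" using j by (simp add: digit_def k)
  qed (simp_all add: digit_def)
qed

lemma Lab_start:
  assumes "B \<in> Lab P"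
  shows "B !! 0 = 1"
  using assms unfolding Lab_def infinite_path_def finite_path_def
  by (auto simp: shift_snth hd_conv_nth Suc_le_eq)

text \<open>Treats infinite and padded finite paths uniformly; the second alternative is the
  padding, which repeats the stop label \<open>length P\<close>.\<close>

lemma Lab_step:
  assumes "B \<in> Lab P"
  shows "B !! t \<in> inner_labels P \<and> succ_label P (B !! t) (B !! Suc t) \<or>
    B !! t = length P \<and> B !! Suc t = length P"
  using assms unfolding Lab_def
proof (elim UnE CollectE exE conjE)
  assume "infinite_path P B"
  then show ?thesis by (auto simp: infinite_path_def streams_iff_snth)
next
  fix p assume B: "B = p @- sconst (last p)" and p: "finite_path P p"
  have "p \<noteq> []" "last p = length P" using p by (auto simp: finite_path_def)
  consider "t + 1 < length p" | "length p \<le> t + 1" by linarith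
  then show ?thesis
  proof cases
    case 1
    then show ?thesis using p by (simp add: B finite_path_def shift_snth del: snth.simps)
  next
    case 2
    have "B !! t = length P"
      using 2 \<open>p \<noteq> []\<close> \<open>last p = length P\<close>
      by (cases "t = length p - 1") (auto simp: B shift_snth last_conv_nth)
    moreover have "B !! Suc t = length P"
      using 2 \<open>last p = length P\<close> by (simp add: B shift_snth del: snth.simps)
    ultimately show ?thesis by simp
  qed
qed

text \<open>A non-branching label has a single successor, so two different ones can only be the two
  jump targets, in either order.\<close>

lemma succ_label_cases:
  assumes "l \<in> inner_labels P" "succ_label P l a" "succ_label P l b" "a \<noteq> b"
  shows "beta_plus P l = Some a \<and> beta_minus P l = Some b \<or>
    beta_plus P l = Some b \<and> beta_minus P l = Some a"
  using assms by (cases "l \<in> branch_labels P") (auto simp: succ_label_def nonbranch_labels_def)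

lemma path_less_total:
  assumes B1: "B1 \<in> Lab P" and B2: "B2 \<in> Lab P" and "B1 \<noteq> B2"
  shows "path_less P B1 B2 \<or> path_less P B2 B1"
proof -
  have "\<exists>j. B1 !! j \<noteq> B2 !! j"
    using \<open>B1 \<noteq> B2\<close> by (metis ext smap_alt stream.map_id0 id_apply stream_smap_nats)
  then obtain j where j: "B1 !! j \<noteq> B2 !! j" "\<forall>i<j. B1 !! i = B2 !! i"
    using exists_least_iff[of "\<lambda>j. B1 !! j \<noteq> B2 !! j"] by blast
  \<comment> \<open>Both paths start with label 1, so the first difference has a predecessor
    position.\<close>
  then obtain k where k: "j = Suc k"
    using Lab_start[OF B1] Lab_start[OF B2] by (cases j) auto
  define l where "l = B1 !! k"
  have l: "B1 !! k = l" "B2 !! k = l" using j(2) by (simp_all add: l_def k)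
  \<comment> \<open>Excludes the padding: if \<open>l\<close> were the stop label, both paths would
    continue with \<open>length P\<close> and agree at \<open>j\<close>.\<close>
  have "length P \<notin> inner_labels P" by (simp add: inner_labels_def)
  then have "l \<in> inner_labels P" "succ_label P l (B1 !! j)" "succ_label P l (B2 !! j)"
    using Lab_step[OF B1, of k] Lab_step[OF B2, of k] j(1) l by (auto simp: k)
  from succ_label_cases[OF this j(1)] show ?thesis
    using j l unfolding path_less_def k by (metis diff_Suc_1 le_add1 plus_1_eq_Suc)
qed

text \<open>Strict monotonicity gives one direction. For the other, if \<open>path_le\<close>
  failed, totality would give \<open>path_less P B2 B1\<close> and hence the reverse strict
  inequality of values.\<close>

lemma path_le_iff_value_le:
  assumes "B1 \<in> Lab P" "B2 \<in> Lab P"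
  shows "path_le P B1 B2 \<longleftrightarrow> path_value P B1 \<le> path_value P B2"
  using path_less_total[OF assms] path_less_imp_value_less[of P B1 B2]
    path_less_imp_value_less[of P B2 B1]
  unfolding path_le_def by fastforce

lemma inj_on_path_value: "inj_on (path_value P) (Lab P)"
  by (rule inj_onI) (metis path_less_total path_less_imp_value_less less_irrefl)

lemma linear_order_on_Lab: "linear_order_on (Lab P) (Lab_order P)"
proof -
  have mem: "(B1, B2) \<in> Lab_order P \<longleftrightarrow>
      B1 \<in> Lab P \<and> B2 \<in> Lab P \<and> path_value P B1 \<le> path_value P B2" for B1 B2
    unfolding Lab_order_def using path_le_iff_value_le by auto
  then show ?thesis
    unfolding order_on_defs
    by (auto simp: mem intro!: refl_onI transI antisymI total_onI
        intro: inj_onD[OF inj_on_path_value])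
qed

theorem theorem4p24:
  fixes \<sigma> :: signature and P :: program
  assumes "is_program \<sigma> P"
  shows "linear_order_on (Lab P) (Lab_order P) \<and>
    (\<exists>f :: nat stream \<Rightarrow> real. inj_on f (Lab P) \<and>
      (\<forall>B1\<in>Lab P. \<forall>B2\<in>Lab P. path_le P B1 B2 \<longleftrightarrow> f B1 \<le> f B2))"
  using linear_order_on_Lab inj_on_path_value path_le_iff_value_le by blast

end
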